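(* The map $\Theta:\mathbb{T}\to\mathbb{R}^3$, $$t=\begin{pmatrix}p_{00}&p_{01}\\ p_{10}&p_{11}\end{pmatrix}\longmapsto\Theta(t)=\left(\ln\sqrt{\frac{p_{00}p_{11}}{p_{01}p_{10}}},\ \ln\sqrt{\frac{p_{00}p_{01}}{p_{10}p_{11}}},\ \ln\sqrt{\frac{p_{00}p_{10}}{p_{01}p_{11}}}\right)$$ is a diffeomorphism. Its inverse $\Psi=\Theta^{-1}:\mathbb{R}^3\to\mathbb{T}$ is given by $$\Psi(x,y,z)=g(e^y,e^z)\left(\begin{pmatrix}\frac{e^x}{2(1+e^x)}&\frac{1}{2(1+e^x)}\\ \frac{1}{2(1+e^x)}&\frac{e^x}{2(1+e^x)}\end{pmatrix}\right)=\frac{1}{e^{x+y+z}+e^x+e^y+e^z}\begin{pmatrix}e^{x+y+z}&e^y\\ e^z&e^x\end{pmatrix}.$$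
   Context: $\mathbb{T}$ is the 3-dimensional manifold of all real $2\times2$ matrices $t=\begin{pmatrix}p_{00}&p_{01}\\ p_{10}&p_{11}\end{pmatrix}$ with $p_{ij}>0$ for all $i,j\in\{0,1\}$ and $\sum_{i,j}p_{ij}=1$. For $\mu,\nu>0$ the map $g(\mu,\nu):\mathbb{T}\to\mathbb{T}$ is $$g(\mu,\nu)(t)=\frac{1}{\mu\nu p_{00}+\mu p_{01}+\nu p_{10}+p_{11}}\begin{pmatrix}\mu\nu p_{00}&\mu p_{01}\\ \nu p_{10}&p_{11}\end{pmatrix}.$$ *)

theory Defs
  imports "HOL-Analysis.Analysis"
begin

text \<open>\<open>Ck_on k U f\<close> is meant for open \<open>U\<close>: all iterated directional derivatives of \<open>f\<close> of order
  at most \<open>k\<close> exist and are continuous on \<open>U\<close>, those of order less than \<open>k\<close> being Frechet differentiable.\<close>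

primrec Ck_on ::
    "nat \<Rightarrow> 'a::euclidean_space set \<Rightarrow> ('a \<Rightarrow> 'b::euclidean_space) \<Rightarrow> bool" where
  "Ck_on 0 U f \<longleftrightarrow> continuous_on U f"
| "Ck_on (Suc k) U f \<longleftrightarrow>
     (\<forall>x\<in>U. f differentiable (at x)) \<and>
     (\<forall>v. Ck_on k U (\<lambda>x. frechet_derivative f (at x) v))"

text \<open>For a map on an arbitrary subset, smoothness means that it extends locally to \<open>C\<^sup>\<infinity>\<close> maps on
  open subsets of the ambient space. On an embedded submanifold this is smoothness for the
  induced differentiable structure.\<close>

definition smooth_map_on :: "'a::euclidean_space set \<Rightarrow> ('a \<Rightarrow> 'b::euclidean_space) \<Rightarrow> bool" where
  "smooth_map_on A f \<longleftrightarrow>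
     (\<forall>a\<in>A. \<exists>U F. open U \<and> a \<in> U \<and> (\<forall>k. Ck_on k U F) \<and> (\<forall>x\<in>U \<inter> A. F x = f x))"

definition diffeomorphism_betw ::
    "('a::euclidean_space \<Rightarrow> 'b::euclidean_space) \<Rightarrow> 'a set \<Rightarrow> 'b set \<Rightarrow> bool" where
  "diffeomorphism_betw f A B \<longleftrightarrow>
     bij_betw f A B \<and> smooth_map_on A f \<and> smooth_map_on B (inv_into A f)"

definition mat2 :: "real \<Rightarrow> real \<Rightarrow> real \<Rightarrow> real \<Rightarrow> real^2^2" where
  "mat2 a b c d = vector [vector [a, b], vector [c, d]]"

text \<open>The entries are traditionally indexed by \<open>{0, 1}\<close>, whereas the rows and columns of a
  \<^typ>\<open>real^2^2\<close> are numbered \<open>1\<close> and \<open>2\<close>.\<close>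

abbreviation p00 :: "real^2^2 \<Rightarrow> real" where "p00 t \<equiv> t $ 1 $ 1"
abbreviation p01 :: "real^2^2 \<Rightarrow> real" where "p01 t \<equiv> t $ 1 $ 2"
abbreviation p10 :: "real^2^2 \<Rightarrow> real" where "p10 t \<equiv> t $ 2 $ 1"
abbreviation p11 :: "real^2^2 \<Rightarrow> real" where "p11 t \<equiv> t $ 2 $ 2"

definition TT :: "(real^2^2) set" where
  "TT = {t. (\<forall>i j. t $ i $ j > 0) \<and> (\<Sum>i\<in>UNIV. \<Sum>j\<in>UNIV. t $ i $ j) = 1}"

definition gmap :: "real \<Rightarrow> real \<Rightarrow> real^2^2 \<Rightarrow> real^2^2" where
  "gmap \<mu> \<nu> t =
     (1 / (\<mu> * \<nu> * p00 t + \<mu> * p01 t + \<nu> * p10 t + p11 t)) *\<^sub>R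
     mat2 (\<mu> * \<nu> * p00 t) (\<mu> * p01 t) (\<nu> * p10 t) (p11 t)"

definition Theta :: "real^2^2 \<Rightarrow> real^3" where
  "Theta t = vector
     [ln (sqrt ((p00 t * p11 t) / (p01 t * p10 t))),
      ln (sqrt ((p00 t * p01 t) / (p10 t * p11 t))),
      ln (sqrt ((p00 t * p10 t) / (p01 t * p11 t)))]"

lemma mat2_nth [simp]:
  "p00 (mat2 a b c d) = a" "p01 (mat2 a b c d) = b"
  "p10 (mat2 a b c d) = c" "p11 (mat2 a b c d) = d"
  by (simp_all add: mat2_def)

lemma TT_iff:
  "t \<in> TT \<longleftrightarrow> p00 t > 0 \<and> p01 t > 0 \<and> p10 t > 0 \<and> p11 t > 0 \<and>
     p00 t + p01 t + p10 t + p11 t = 1"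
  by (auto simp: TT_def sum_2 forall_2)

lemma gmap_in_TT:
  assumes "\<mu> > 0" "\<nu> > 0" "t \<in> TT"
  shows "gmap \<mu> \<nu> t \<in> TT"
proof -
  have p: "p00 t > 0" "p01 t > 0" "p10 t > 0" "p11 t > 0"
    using assms(3) by (auto simp: TT_iff)
  define N where "N = \<mu> * \<nu> * p00 t + \<mu> * p01 t + \<nu> * p10 t + p11 t"
  have "N > 0"
    unfolding N_def using p assms by (intro add_pos_pos mult_pos_pos)
  then show ?thesis
    using p assms unfolding TT_iff gmap_def N_def [symmetric]
    by (simp add: add_divide_distrib [symmetric] N_def [symmetric])
qed

lemma symmetric_base_in_TT:
  "mat2 (exp x / (2 * (1 + exp x))) (1 / (2 * (1 + exp x)))
        (1 / (2 * (1 + exp x))) (exp x / (2 * (1 + exp x))) \<in> TT"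
proof -
  have pos: "1 + exp x > 0" by (simp add: add_pos_pos)
  have "exp x / (2 * (1 + exp x)) + 1 / (2 * (1 + exp x)) = 1 / 2"
    using pos by (simp add: add_divide_distrib [symmetric] field_simps)
  then show ?thesis using pos by (simp add: TT_iff mult.commute)
qed

end

theory Submission
  imports Defs
begin

text \<open>In the logarithmic coordinates \<open>ln p\<^sub>i\<^sub>j\<close> the map \<open>Theta\<close> is linear, with kernel spanned by the
  direction in which all four entries are rescaled simultaneously; the normalisation of the sum of
  the entries removes exactly this freedom. Explicitly, if \<open>Theta t = (x, y, z)\<close> then
  \<open>(x + y + z, y, z, x)\<close> differs from \<open>(ln p\<^sub>0\<^sub>0, ln p\<^sub>0\<^sub>1, ln p\<^sub>1\<^sub>0, ln p\<^sub>1\<^sub>1)\<close> by a multiple of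
  \<open>(1, 1, 1, 1)\<close>. Both \<open>Theta\<close> and its inverse are built from coordinates by \<open>ln\<close>, \<open>exp\<close>, inversion
  and products, hence are smooth on open sets of the ambient spaces.\<close>

section \<open>Closure properties of maps of class \<open>C^k\<close> on open sets\<close>

text \<open>On an open \<open>U\<close> the derivative at a point depends only on the values in
  \<open>U\<close>, so equality on \<open>U\<close> passes to all directional derivatives. The
  induction therefore varies \<open>f\<close> and \<open>g\<close>.\<close>

lemma Ck_on_cong:
  assumes "open U" "\<And>x. x \<in> U \<Longrightarrow> f x = g x" "Ck_on k U f"
  shows "Ck_on k U g"
  using assms(2,3)
proof (induction k arbitrary: f g)
  case 0
  then show ?case
    using continuous_on_cong[of U U f g] by simp
next
  case (Suc k)
  have d: "(g has_derivative frechet_derivative f (at x)) (at x)" if "x \<in> U" for x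
  proof -
    have "(f has_derivative frechet_derivative f (at x)) (at x)"
      using Suc.prems(2) that by (simp add: frechet_derivative_works)
    then show ?thesis
      using has_derivative_transform_within_open[OF _ \<open>open U\<close> that] Suc.prems(1) by blast
  qed
  have "Ck_on k U (\<lambda>x. frechet_derivative g (at x) v)" for v
  proof (rule Suc.IH)
    show "Ck_on k U (\<lambda>x. frechet_derivative f (at x) v)"
      using Suc.prems(2) by simp
    show "frechet_derivative f (at x) v = frechet_derivative g (at x) v" if "x \<in> U" for x
      using frechet_derivative_at[OF d[OF that]] by (rule fun_cong)
  qed
  then show ?case
    using d by (auto simp: differentiable_def)
qed

text \<open>Replaces the choice operator \<open>frechet_derivative\<close> by an explicit derivative
  \<open>D\<close>. The two agree only on \<open>U\<close>, so \<open>Ck_on_cong\<close> transfers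
  the regularity.\<close>

lemma Ck_on_SucI:
  assumes "open U" "\<And>x. x \<in> U \<Longrightarrow> (f has_derivative D x) (at x)"
    and "\<And>v. Ck_on k U (\<lambda>x. D x v)"
  shows "Ck_on (Suc k) U f"
proof -
  have "Ck_on k U (\<lambda>x. frechet_derivative f (at x) v)" for v
  proof (rule Ck_on_cong[OF \<open>open U\<close> _ assms(3)])
    show "D x v = frechet_derivative f (at x) v" if "x \<in> U" for x
      using frechet_derivative_at[OF assms(2)[OF that]] by (rule fun_cong)
  qed
  then show ?thesis
    using assms(2) by (auto simp: differentiable_def)
qed

lemma Ck_on_SucD:
  assumes "Ck_on (Suc k) U f"
  shows "x \<in> U \<Longrightarrow> (f has_derivative frechet_derivative f (at x)) (at x)"
    and "Ck_on k U (\<lambda>x. frechet_derivative f (at x) v)"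
  using assms by (auto simp: frechet_derivative_works)

lemma Ck_on_Suc_imp_Ck_on: "Ck_on (Suc k) U f \<Longrightarrow> Ck_on k U f"
proof (induction k arbitrary: f)
  case 0
  then show ?case
    by (auto intro!: continuous_at_imp_continuous_on differentiable_imp_continuous_within)
next
  case (Suc k)
  have "Ck_on k U (\<lambda>x. frechet_derivative f (at x) v)" for v
    by (rule Suc.IH[OF Ck_on_SucD(2)[OF Suc.prems]])
  with Suc.prems show ?case by simp
qed

lemma Ck_on_const: "open U \<Longrightarrow> Ck_on k U (\<lambda>x. c)"
proof (induction k arbitrary: c)
  case 0
  show ?case by simp
next
  case (Suc k)
  then show ?case
    by (intro Ck_on_SucI[where D = "\<lambda>_ _. 0"]) auto
qed

text \<open>The derivative at every point is \<open>f\<close> itself, so each directional derivative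
  is constant.\<close>

lemma Ck_on_bounded_linear:
  assumes "open U" "bounded_linear f"
  shows "Ck_on k U f"
proof (cases k)
  case 0
  then show ?thesis
    using assms(2) by (simp add: linear_continuous_on)
next
  case (Suc m)
  have "Ck_on (Suc m) U f"
    by (rule Ck_on_SucI[where D = "\<lambda>_. f"])
      (use assms in \<open>auto intro: Ck_on_const bounded_linear_imp_has_derivative\<close>)
  with Suc show ?thesis by simp
qed

lemma Ck_on_add:
  assumes "open U" "Ck_on k U f" "Ck_on k U g"
  shows "Ck_on k U (\<lambda>x. f x + g x)"
  using assms(2,3)
proof (induction k arbitrary: f g)
  case 0
  then show ?case by (simp add: continuous_on_add)
next
  case (Suc k)
  show ?case
  proof (rule Ck_on_SucI[OF \<open>open U\<close>])
    show "((\<lambda>x. f x + g x) has_derivative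
        (\<lambda>v. frechet_derivative f (at x) v + frechet_derivative g (at x) v)) (at x)"
      if "x \<in> U" for x
      using Suc.prems[THEN Ck_on_SucD(1), OF that] by (rule has_derivative_add)
    show "Ck_on k U (\<lambda>x. frechet_derivative f (at x) v + frechet_derivative g (at x) v)" for v
      using Suc.prems[THEN Ck_on_SucD(2)] by (rule Suc.IH)
  qed
qed

lemma Ck_on_scaleR:
  fixes f :: "'a::euclidean_space \<Rightarrow> real" and g :: "'a \<Rightarrow> 'b::euclidean_space"
  assumes "open U" "Ck_on k U f" "Ck_on k U g"
  shows "Ck_on k U (\<lambda>x. f x *\<^sub>R g x)"
  using assms(2,3)
proof (induction k arbitrary: f g)
  case 0
  then show ?case by (simp add: continuous_on_scaleR)
next
  case (Suc k)
  show ?case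
  proof (rule Ck_on_SucI[OF \<open>open U\<close>])
    show "((\<lambda>x. f x *\<^sub>R g x) has_derivative
        (\<lambda>v. f x *\<^sub>R frechet_derivative g (at x) v + frechet_derivative f (at x) v *\<^sub>R g x)) (at x)"
      if "x \<in> U" for x
      using Suc.prems[THEN Ck_on_SucD(1), OF that] by (rule has_derivative_scaleR)
    \<comment> \<open>The product rule pairs each factor with a derivative of the other. The
      induction hypothesis thus also needs \<open>f\<close> and \<open>g\<close> themselves at order
      \<open>k\<close>, one below their given order.\<close>
    show "Ck_on k U (\<lambda>x. f x *\<^sub>R frechet_derivative g (at x) v + frechet_derivative f (at x) v *\<^sub>R g x)" for v
      using Suc.prems[THEN Ck_on_SucD(2)] Suc.prems[THEN Ck_on_Suc_imp_Ck_on]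
      by (intro Ck_on_add[OF \<open>open U\<close>] Suc.IH)
  qed
qed

lemma Ck_on_mult:
  fixes f g :: "'a::euclidean_space \<Rightarrow> real"
  assumes "open U" "Ck_on k U f" "Ck_on k U g"
  shows "Ck_on k U (\<lambda>x. f x * g x)"
  using Ck_on_scaleR[OF assms] by simp

lemma Ck_on_diff:
  assumes "open U" "Ck_on k U f" "Ck_on k U g"
  shows "Ck_on k U (\<lambda>x. f x - g x)"
  using Ck_on_add[OF assms(1,2) Ck_on_scaleR[OF assms(1) Ck_on_const[OF assms(1)] assms(3)], of "-1"]
  by simp

text \<open>Regularity is demanded of the composite \<open>h' (f x)\<close> rather than of
  \<open>h\<close>. An induction can then supply it whenever \<open>h'\<close> is expressible
  through \<open>h\<close>, and \<open>h\<close> may be singular away from the values of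
  \<open>f\<close>.\<close>

lemma Ck_on_chain_real:
  fixes f :: "'a::euclidean_space \<Rightarrow> real" and h h' :: "real \<Rightarrow> real"
  assumes "open U" "Ck_on (Suc k) U f" "Ck_on k U (\<lambda>x. h' (f x))"
    and "\<And>x. x \<in> U \<Longrightarrow> (h has_real_derivative h' (f x)) (at (f x))"
  shows "Ck_on (Suc k) U (\<lambda>x. h (f x))"
proof (rule Ck_on_SucI[OF assms(1)])
  show "((\<lambda>x. h (f x)) has_derivative (\<lambda>v. h' (f x) * frechet_derivative f (at x) v)) (at x)"
    if "x \<in> U" for x
    using has_derivative_compose[OF Ck_on_SucD(1)[OF assms(2) that]
        assms(4)[OF that, unfolded has_field_derivative_def]]
    by simp
  show "Ck_on k U (\<lambda>x. h' (f x) * frechet_derivative f (at x) v)" for v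
    by (rule Ck_on_mult[OF assms(1,3) Ck_on_SucD(2)[OF assms(2)]])
qed

lemma Ck_on_exp:
  fixes f :: "'a::euclidean_space \<Rightarrow> real"
  assumes "open U" "Ck_on k U f"
  shows "Ck_on k U (\<lambda>x. exp (f x))"
  using assms(2)
proof (induction k)
  case 0
  then show ?case by (simp add: continuous_on_exp)
next
  case (Suc k)
  show ?case
    by (rule Ck_on_chain_real[OF \<open>open U\<close> Suc.prems Suc.IH[OF Ck_on_Suc_imp_Ck_on[OF Suc.prems]]])
      (rule DERIV_exp)
qed

lemma Ck_on_inverse:
  fixes f :: "'a::euclidean_space \<Rightarrow> real"
  assumes "open U" "\<And>x. x \<in> U \<Longrightarrow> f x \<noteq> 0" "Ck_on k U f"
  shows "Ck_on k U (\<lambda>x. inverse (f x))"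
  using assms(3)
proof (induction k)
  case 0
  then show ?case using assms(2) by (simp add: continuous_on_inverse)
next
  case (Suc k)
  have "Ck_on k U (\<lambda>x. inverse (f x))"
    by (rule Suc.IH[OF Ck_on_Suc_imp_Ck_on[OF Suc.prems]])
  \<comment> \<open>The derivative of \<open>inverse\<close> is a polynomial in
    \<open>inverse\<close>, which closes the induction.\<close>
  then have "Ck_on k U (\<lambda>x. (-1) * (inverse (f x) * inverse (f x)))"
    by (intro Ck_on_mult Ck_on_const \<open>open U\<close>)
  then show ?case
    using assms(2)
    by (intro Ck_on_chain_real[OF \<open>open U\<close> Suc.prems, where h' = "\<lambda>y. (-1) * (inverse y * inverse y)"])
      (auto intro!: derivative_eq_intros)
qed

text \<open>The derivative of \<open>ln\<close> is \<open>inverse\<close>, already treated at every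
  order, so a case distinction replaces induction.\<close>

lemma Ck_on_ln:
  fixes f :: "'a::euclidean_space \<Rightarrow> real"
  assumes "open U" "\<And>x. x \<in> U \<Longrightarrow> f x > 0" "Ck_on k U f"
  shows "Ck_on k U (\<lambda>x. ln (f x))"
proof (cases k)
  case 0
  have "\<forall>x\<in>U. f x \<noteq> 0"
    using assms(2) by force
  with 0 assms(3) show ?thesis by (simp add: continuous_on_ln)
next
  case (Suc m)
  have "f x \<noteq> 0" if "x \<in> U" for x
    using assms(2)[OF that] by simp
  then have inv: "Ck_on m U (\<lambda>x. inverse (f x))"
    using Ck_on_Suc_imp_Ck_on[OF assms(3)[unfolded Suc]] by (rule Ck_on_inverse[OF \<open>open U\<close>])
  have "(ln has_real_derivative inverse (f x)) (at (f x))" if "x \<in> U" for x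
    using assms(2)[OF that] by (rule DERIV_ln)
  then show ?thesis
    unfolding Suc by (rule Ck_on_chain_real[OF \<open>open U\<close> assms(3)[unfolded Suc] inv])
qed

lemma smooth_map_onI:
  assumes "open U" "A \<subseteq> U" "\<And>k. Ck_on k U F" "\<And>x. x \<in> A \<Longrightarrow> F x = f x"
  shows "smooth_map_on A f"
  unfolding smooth_map_on_def
proof
  fix a
  assume "a \<in> A"
  with assms show "\<exists>U F. open U \<and> a \<in> U \<and> (\<forall>k. Ck_on k U F) \<and> (\<forall>x\<in>U \<inter> A. F x = f x)"
    by (intro exI[of _ U] exI[of _ F]) auto
qed

text \<open>Scalar functions times constant vectors reduce smoothness of a vector-valued map to that
  of its coordinates.\<close>

lemma vector3_eq_scaleR_axis:
  "(vector [a, b, c] :: real^3) = a *\<^sub>R axis 1 1 + b *\<^sub>R axis 2 1 + c *\<^sub>R axis 3 1"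
  by (simp add: vec_eq_iff forall_3 axis_def)

lemma mat2_eq_scaleR:
  "mat2 a b c d =
     a *\<^sub>R mat2 1 0 0 0 + b *\<^sub>R mat2 0 1 0 0 + c *\<^sub>R mat2 0 0 1 0 + d *\<^sub>R mat2 0 0 0 1"
  by (simp add: vec_eq_iff forall_2)

section \<open>The explicit inverse\<close>

text \<open>The closed form serves as definition because smoothness and the inverse laws are read
  off from it; the form through \<open>gmap\<close> is matched with it afterwards.\<close>

definition Psi :: "real^3 \<Rightarrow> real^2^2" where
  "Psi v = (1 / (exp (v $ 1 + v $ 2 + v $ 3) + exp (v $ 1) + exp (v $ 2) + exp (v $ 3))) *\<^sub>R
     mat2 (exp (v $ 1 + v $ 2 + v $ 3)) (exp (v $ 2)) (exp (v $ 3)) (exp (v $ 1))"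

lemma Psi_in_TT: "Psi v \<in> TT"
proof -
  define N where "N = exp (v $ 1 + v $ 2 + v $ 3) + exp (v $ 1) + exp (v $ 2) + exp (v $ 3)"
  have "N > 0"
    unfolding N_def by (intro add_pos_pos exp_gt_zero)
  moreover have "exp (v $ 1 + v $ 2 + v $ 3) / N + exp (v $ 2) / N + exp (v $ 3) / N + exp (v $ 1) / N = N / N"
    unfolding N_def by (simp flip: add_divide_distrib add: add_ac)
  ultimately show ?thesis
    unfolding TT_iff Psi_def N_def[symmetric] by simp
qed

lemma Theta_eq_ln:
  assumes "p00 t > 0" "p01 t > 0" "p10 t > 0" "p11 t > 0"
  shows "Theta t = vector
    [(ln (p00 t) + ln (p11 t) - ln (p01 t) - ln (p10 t)) / 2,
     (ln (p00 t) + ln (p01 t) - ln (p10 t) - ln (p11 t)) / 2,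
     (ln (p00 t) + ln (p10 t) - ln (p01 t) - ln (p11 t)) / 2]"
  using assms by (simp add: Theta_def ln_sqrt ln_div ln_mult diff_diff_eq)

lemma Theta_Psi: "Theta (Psi v) = v"
proof -
  define N where "N = exp (v $ 1 + v $ 2 + v $ 3) + exp (v $ 1) + exp (v $ 2) + exp (v $ 3)"
  have "N > 0"
    unfolding N_def by (intro add_pos_pos exp_gt_zero)
  \<comment> \<open>The normalisation shifts all four logarithms by \<open>- ln N\<close>. Each
    coordinate of \<open>Theta\<close> has two plus and two minus signs, so the shift
    cancels.\<close>
  then have "ln (p00 (Psi v)) = v $ 1 + v $ 2 + v $ 3 - ln N" "ln (p01 (Psi v)) = v $ 2 - ln N"
    "ln (p10 (Psi v)) = v $ 3 - ln N" "ln (p11 (Psi v)) = v $ 1 - ln N"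
    unfolding Psi_def N_def[symmetric] by (simp_all add: ln_div)
  with Psi_in_TT[of v] show ?thesis
    by (simp add: TT_iff Theta_eq_ln vec_eq_iff forall_3)
qed

lemma Psi_Theta:
  assumes "t \<in> TT"
  shows "Psi (Theta t) = t"
proof -
  have pos: "p00 t > 0" "p01 t > 0" "p10 t > 0" "p11 t > 0"
    and sum: "p00 t + p01 t + p10 t + p11 t = 1"
    using assms by (auto simp: TT_iff)
  \<comment> \<open>The common shift between the exponents used by \<open>Psi\<close> and the
    logarithms of the entries, obtained as \<open>?v $ 1 - ln (p11 t)\<close>.\<close>
  define s where "s = (ln (p00 t) - ln (p01 t) - ln (p10 t) - ln (p11 t)) / 2"
  let ?v = "Theta t"
  have "?v $ 1 + ?v $ 2 + ?v $ 3 = s + ln (p00 t)" "?v $ 1 = s + ln (p11 t)"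
    "?v $ 2 = s + ln (p01 t)" "?v $ 3 = s + ln (p10 t)"
    by (simp_all add: Theta_eq_ln[OF pos] s_def field_simps)
  then have e: "exp (?v $ 1 + ?v $ 2 + ?v $ 3) = exp s * p00 t" "exp (?v $ 1) = exp s * p11 t"
    "exp (?v $ 2) = exp s * p01 t" "exp (?v $ 3) = exp s * p10 t"
    using pos by (simp_all only: exp_add exp_ln)
  \<comment> \<open>Since the entries sum to 1, the denominator in \<open>Psi\<close> is
    \<open>exp s\<close>, which cancels the common factor.\<close>
  have "exp s * p00 t + exp s * p11 t + exp s * p01 t + exp s * p10 t = exp s"
    using sum by (simp flip: distrib_left add: add_ac)
  then show ?thesis
    unfolding Psi_def e by (simp add: vec_eq_iff forall_2)
qed

lemma bij_betw_Theta: "bij_betw Theta TT UNIV"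
  by (rule bij_betw_byWitness[where f' = Psi]) (auto simp: Psi_Theta Theta_Psi Psi_in_TT)

lemma inv_into_Theta: "inv_into TT Theta v = Psi v"
  by (rule inv_into_f_eq) (use bij_betw_Theta in \<open>auto simp: bij_betw_def Theta_Psi Psi_in_TT\<close>)

section \<open>Smoothness in both directions\<close>

lemma smooth_Theta: "smooth_map_on TT Theta"
proof -
  \<comment> \<open>Dropping the condition on the sum thickens \<open>TT\<close> to an open set of
    matrices on which all four logarithms are still smooth.\<close>
  define U where "U = {t. p00 t > 0 \<and> p01 t > 0 \<and> p10 t > 0 \<and> p11 t > 0}"
  have U: "open U"
    unfolding U_def by (intro open_Collect_conj open_Collect_less continuous_intros)
  have coord: "Ck_on k U (\<lambda>t. ln (t $ i $ j))" if "\<And>t. t \<in> U \<Longrightarrow> t $ i $ j > 0" for k i j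
    by (intro Ck_on_ln U that Ck_on_bounded_linear
        bounded_linear_compose[OF bounded_linear_vec_nth bounded_linear_vec_nth])
  define F :: "real^2^2 \<Rightarrow> real^3" where "F t =
      ((1/2) * (ln (p00 t) + ln (p11 t) - ln (p01 t) - ln (p10 t))) *\<^sub>R axis 1 1 +
      ((1/2) * (ln (p00 t) + ln (p01 t) - ln (p10 t) - ln (p11 t))) *\<^sub>R axis 2 1 +
      ((1/2) * (ln (p00 t) + ln (p10 t) - ln (p01 t) - ln (p11 t))) *\<^sub>R axis 3 1" for t
  have "Ck_on k U F" for k
    unfolding F_def
    by (intro Ck_on_add Ck_on_scaleR Ck_on_mult Ck_on_diff Ck_on_const U coord) (auto simp: U_def)
  moreover have "F t = Theta t" if "t \<in> TT" for t
    using that by (simp add: TT_iff Theta_eq_ln vector3_eq_scaleR_axis F_def)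
  moreover have "TT \<subseteq> U"
    by (auto simp: U_def TT_iff)
  ultimately show ?thesis
    by (intro smooth_map_onI[OF U])
qed

lemma Ck_on_Psi: "Ck_on k UNIV Psi"
proof -
  have coord: "Ck_on k UNIV (\<lambda>v::real^3. v $ i)" for i
    by (intro Ck_on_bounded_linear open_UNIV bounded_linear_vec_nth)
  have N: "exp (v $ 1 + v $ 2 + v $ 3) + exp (v $ 1) + exp (v $ 2) + exp (v $ 3) \<noteq> 0" for v :: "real^3"
    by (rule less_imp_neq[symmetric]) (intro add_pos_pos exp_gt_zero)
  let ?N = "\<lambda>v::real^3. exp (v $ 1 + v $ 2 + v $ 3) + exp (v $ 1) + exp (v $ 2) + exp (v $ 3)"
  have exps: "Ck_on k UNIV (\<lambda>v::real^3. exp (v $ 1 + v $ 2 + v $ 3))"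
    "Ck_on k UNIV (\<lambda>v::real^3. exp (v $ i))" for i
    by (intro Ck_on_exp Ck_on_add open_UNIV coord)+
  have "Ck_on k UNIV ?N"
    by (intro Ck_on_add open_UNIV exps)
  then have inv: "Ck_on k UNIV (\<lambda>v. inverse (?N v))"
    using N by (intro Ck_on_inverse open_UNIV)
  have mat: "Ck_on k UNIV (\<lambda>v::real^3. exp (v $ 1 + v $ 2 + v $ 3) *\<^sub>R mat2 1 0 0 0 +
      exp (v $ 2) *\<^sub>R mat2 0 1 0 0 + exp (v $ 3) *\<^sub>R mat2 0 0 1 0 + exp (v $ 1) *\<^sub>R mat2 0 0 0 1)"
    by (intro Ck_on_add Ck_on_scaleR Ck_on_const open_UNIV exps)
  \<comment> \<open>This form is a scalar function times a combination of constant matrices, as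
    \<open>inv\<close> and \<open>mat\<close> require.\<close>
  have "Psi = (\<lambda>v. inverse (?N v) *\<^sub>R (exp (v $ 1 + v $ 2 + v $ 3) *\<^sub>R mat2 1 0 0 0 +
      exp (v $ 2) *\<^sub>R mat2 0 1 0 0 + exp (v $ 3) *\<^sub>R mat2 0 0 1 0 + exp (v $ 1) *\<^sub>R mat2 0 0 0 1))"
    unfolding Psi_def
    unfolding inverse_eq_divide by (subst mat2_eq_scaleR) (rule refl)
  then show ?thesis
    using Ck_on_scaleR[OF open_UNIV inv mat] by (simp only:)
qed

section \<open>The inverse in terms of \<open>gmap\<close>\<close>

lemma gmap_symmetric_base_eq_Psi:
  "gmap (exp y) (exp z)
     (mat2 (exp x / (2 * (1 + exp x))) (1 / (2 * (1 + exp x)))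
           (1 / (2 * (1 + exp x))) (exp x / (2 * (1 + exp x)))) = Psi (vector [x, y, z])"
proof -
  \<comment> \<open>The common denominator of the base matrix: it divides both the entries and the
    normalising sum in \<open>gmap\<close>, hence cancels.\<close>
  define k where "k = 2 * (1 + exp x)"
  have "k > 0"
    unfolding k_def by (simp add: add_pos_pos)
  define N where "N = exp (x + y + z) + exp x + exp y + exp z"
  have "N > 0"
    unfolding N_def by (intro add_pos_pos exp_gt_zero)
  have den: "exp y * exp z * (exp x / k) + exp y * (1 / k) + exp z * (1 / k) + exp x / k = N / k"
    using \<open>k > 0\<close> by (simp add: N_def exp_add field_simps)
  show ?thesis
    unfolding gmap_def Psi_def k_def[symmetric] mat2_nth vector_3 den N_def[symmetric]
    using \<open>k > 0\<close> \<open>N > 0\<close> by (simp add: vec_eq_iff forall_2 exp_add field_simps)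
qed

theorem proposition2:
  shows "diffeomorphism_betw Theta TT (UNIV :: (real^3) set) \<and>
    (\<forall>x y z :: real.
      inv_into TT Theta (vector [x, y, z]) =
        gmap (exp y) (exp z)
            (mat2 (exp x / (2 * (1 + exp x))) (1 / (2 * (1 + exp x)))
                  (1 / (2 * (1 + exp x))) (exp x / (2 * (1 + exp x)))) \<and>
      gmap (exp y) (exp z)
            (mat2 (exp x / (2 * (1 + exp x))) (1 / (2 * (1 + exp x)))
                  (1 / (2 * (1 + exp x))) (exp x / (2 * (1 + exp x)))) =
        (1 / (exp (x + y + z) + exp x + exp y + exp z)) *\<^sub>R
          mat2 (exp (x + y + z)) (exp y) (exp z) (exp x))"
proof (intro conjI allI)
  show "diffeomorphism_betw Theta TT (UNIV :: (real^3) set)"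
    unfolding diffeomorphism_betw_def
    \<comment> \<open>As \<open>UNIV\<close> is open, \<open>Psi\<close> is its own smooth
      extension.\<close>
    using bij_betw_Theta smooth_Theta smooth_map_onI[OF open_UNIV order_refl Ck_on_Psi]
    by (simp add: inv_into_Theta)
qed (simp_all only: gmap_symmetric_base_eq_Psi inv_into_Theta Psi_def vector_3)

end
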